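(* Let $(A,\cdot,\diamond,\varepsilon,\alpha)$ be a Hom-Novikov-Poisson color Hom-algebra and let $(s,l,r,\beta,V)$ be a bimodule of it. Let $A\oplus V=\bigoplus_{\gamma\in\Gamma}(A_\gamma\oplus V_\gamma)$ be the direct sum of $\Gamma$-graded linear spaces, with the operations given, for $x_1+v_1\in A_{\gamma_1}\oplus V_{\gamma_1}$ and $x_2+v_2\in A_{\gamma_2}\oplus V_{\gamma_2}$ (and extended bilinearly), by $$(x_1+v_1)\cdot'(x_2+v_2)=x_1\cdot x_2+s(x_1)v_2+\varepsilon(\gamma_1,\gamma_2)\,s(x_2)v_1,$$ $$(x_1+v_1)\diamond'(x_2+v_2)=x_1\diamond x_2+l(x_1)v_2+r(x_2)v_1,$$ and $(\alpha+\beta)(x_1+v_1)=\alpha(x_1)+\beta(v_1)$. Then $(A\oplus V,\cdot',\diamond',\varepsilon,\alpha+\beta)$ is a Hom-Novikov-Poisson color Hom-algebra.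
   Context: $\mathbb K$ is an algebraically closed field of characteristic $0$; all spaces are over $\mathbb K$. $\Gamma$ is an abelian group and $\varepsilon:\Gamma\times\Gamma\to\mathbb K^*=\mathbb K\setminus\{0\}$ is a commutation factor: $\varepsilon(a,b)\varepsilon(b,a)=1$, $\varepsilon(a,b+c)=\varepsilon(a,b)\varepsilon(a,c)$, $\varepsilon(a+b,c)=\varepsilon(a,c)\varepsilon(b,c)$. For a $\Gamma$-graded linear space $V$, $\mathcal H(V)$ is the set of homogeneous elements; inside $\varepsilon$ a homogeneous element stands for its degree (so $\varepsilon(x+v,y)=\varepsilon(\deg x+\deg v,\deg y)$). A linear map is even if it preserves degrees; a bilinear multiplication on $A$ is even if $A_\gamma A_{\gamma'}\subseteq A_{\gamma+\gamma'}$; a linear map $s:A\to \mathrm{End}(V)$ is even if $s(A_\gamma)V_{\gamma'}\subseteq V_{\gamma+\gamma'}$. A color Hom-algebra $(A,\cdot,\varepsilon,\alpha)$ is a $\Gamma$-graded space $A$ with an even bilinear multiplication $\cdot$ and an even linear map $\alpha:A\to A$ (not assumed multiplicative). All identities are for all homogeneous $x,y,z\in\mathcal H(A)$, $v\in\mathcal H(V)$. $\varepsilon$-commutative Hom-associative color Hom-algebra $(A,\cdot,\varepsilon,\alpha)$: $\alpha(x)\cdot(y\cdot z)=(x\cdot y)\cdot\alpha(z)$ and $x\cdot y=\varepsilon(x,y)y\cdot x$. A bimodule of it is a triple $(s,\beta,V)$, with $V$ a $\Gamma$-graded space, $\beta:V\to V$ even linear, $s:A\to\mathrm{End}(V)$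 even linear, such that $s(x\cdot y)\beta(v)=s(\alpha(x))s(y)v$. Hom-Novikov color Hom-algebra $(A,\diamond,\varepsilon,\alpha)$: $(x\diamond y)\diamond\alpha(z)-\alpha(x)\diamond(y\diamond z)=\varepsilon(x,y)\big((y\diamond x)\diamond\alpha(z)-\alpha(y)\diamond(x\diamond z)\big)$ and $(x\diamond y)\diamond\alpha(z)=\varepsilon(y,z)(x\diamond z)\diamond\alpha(y)$. A bimodule of it is a quadruple $(l,r,\beta,V)$ with $\beta:V\to V$ and $l,r:A\to\mathrm{End}(V)$ even linear such that (1) $l(x\diamond y)\beta(v)-l(\alpha(x))l(y)v=\varepsilon(x,y)\big(l(y\diamond x)\beta(v)-l(\alpha(y))l(x)v\big)$; (2) $r(\alpha(y))l(x)v-l(\alpha(x))r(y)v=\varepsilon(x,v)\big(r(\alpha(y))r(x)v-r(x\diamond y)\beta(v)\big)$; (3) $r(\alpha(y))r(x)v-r(x\diamond y)\beta(v)=\varepsilon(v,x)\big(r(\alpha(y))l(x)v-l(\alpha(x))r(y)v\big)$; (4) $l(x\diamond y)\beta(v)=\varepsilon(y,v)r(\alpha(y))l(x)v$; (5) $r(\alpha(y))l(x)v=\varepsilon(v,y)l(x\diamond y)\beta(v)$; (6) $r(\alpha(y))r(x)v=\varepsilon(x,y)r(\alpha(x))r(y)v$. Hom-Novikov-Poisson color Hom-algebra $(A,\cdot,\diamond,\varepsilon,\alpha)$: $(A,\cdot,\varepsilon,\alpha)$ is $\varepsilon$-commutative Hom-associative, $(A,\diamond,\varepsilon,\alpha)$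 is Hom-Novikov, and $(x\cdot y)\diamond\alpha(z)=\varepsilon(y,z)(x\diamond z)\cdot\alpha(y)$, $(x\diamond y)\cdot\alpha(z)-\alpha(x)\diamond(y\cdot z)=\varepsilon(x,y)\big((y\diamond x)\cdot\alpha(z)-\alpha(y)\diamond(x\cdot z)\big)$. A bimodule of a Hom-Novikov-Poisson color Hom-algebra $(A,\cdot,\diamond,\varepsilon,\alpha)$ is a quintuple $(s,l,r,\beta,V)$ such that $(s,\beta,V)$ is a bimodule of $(A,\cdot,\varepsilon,\alpha)$, $(l,r,\beta,V)$ is a bimodule of $(A,\diamond,\varepsilon,\alpha)$, and (a) $l(x\cdot y)\beta(v)=\varepsilon(x,y)s(\alpha(y))l(x)v$; (b) $r(\alpha(y))s(x)v=\varepsilon(v,y)s(x\diamond y)\beta(v)$; (c) $r(\alpha(y))s(x)v=s(\alpha(x))r(y)v$; (d) $s(x\diamond y)\beta(v)-l(\alpha(x))s(y)v=\varepsilon(x,y)\big(s(y\diamond x)\beta(v)-l(\alpha(y))s(x)v\big)$; (e) $\varepsilon(x+v,y)\big(s(\alpha(y))l(x)v-\varepsilon(x,v)s(\alpha(y))r(x)v\big)=\varepsilon(v,y)l(\alpha(x))s(y)v-\varepsilon(x,v)r(x\cdot y)\beta(v)$. *)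

theory Defs
  imports "HOL-Analysis.Product_Vector" "HOL-Computational_Algebra.Polynomial"
begin

section \<open>Graded spaces\<close>

definition homogeneous_decomposition ::
    "('g \<Rightarrow> 'v::ab_group_add set) \<Rightarrow> 'v \<Rightarrow> ('g \<Rightarrow> 'v) \<Rightarrow> bool" where
  "homogeneous_decomposition G x f \<longleftrightarrow>
     (\<forall>\<gamma>. f \<gamma> \<in> G \<gamma>) \<and> finite {\<gamma>. f \<gamma> \<noteq> 0} \<and> x = (\<Sum>\<gamma> | f \<gamma> \<noteq> 0. f \<gamma>)"

text \<open>
  The space is a whole type with a scalar multiplication, and it is the internal direct sum of
  the subspaces \<open>G \<gamma>\<close>. The zero vector belongs to every \<open>G \<gamma>\<close>; all identities below are
  therefore stated for elements together with a degree.
\<close>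

locale graded_space = vector_space scale
  for scale :: "'k::field \<Rightarrow> 'v::ab_group_add \<Rightarrow> 'v" +
  fixes G :: "'g::ab_group_add \<Rightarrow> 'v set"
  assumes subspace_G: "subspace (G \<gamma>)"
    and direct_sum: "\<exists>!f. homogeneous_decomposition G x f"

definition homogeneous_component ::
    "('g \<Rightarrow> 'v::ab_group_add set) \<Rightarrow> 'v \<Rightarrow> 'g \<Rightarrow> 'v" where
  "homogeneous_component G x = (THE f. homogeneous_decomposition G x f)"

definition even_linear ::
    "('k::field \<Rightarrow> 'u::ab_group_add \<Rightarrow> 'u) \<Rightarrow> ('g \<Rightarrow> 'u set) \<Rightarrow>
     ('k \<Rightarrow> 'v::ab_group_add \<Rightarrow> 'v) \<Rightarrow> ('g \<Rightarrow> 'v set) \<Rightarrow> ('u \<Rightarrow> 'v) \<Rightarrow> bool" where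
  "even_linear scaleU GU scaleV GV f \<longleftrightarrow>
     Vector_Spaces.linear scaleU scaleV f \<and> (\<forall>\<gamma>. \<forall>x \<in> GU \<gamma>. f x \<in> GV \<gamma>)"

text \<open>
  Used with \<open>U = V = W = A\<close> for a multiplication on \<open>A\<close>, and with \<open>U = A\<close> and \<open>W = V\<close> for a
  linear map from \<open>A\<close> to \<open>End(V)\<close>, which is the same as a bilinear map from \<open>A\<close> and \<open>V\<close> to \<open>V\<close>.
\<close>

definition even_bilinear ::
    "('k::field \<Rightarrow> 'u::ab_group_add \<Rightarrow> 'u) \<Rightarrow> ('g::ab_group_add \<Rightarrow> 'u set) \<Rightarrow>
     ('k \<Rightarrow> 'v::ab_group_add \<Rightarrow> 'v) \<Rightarrow> ('g \<Rightarrow> 'v set) \<Rightarrow>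
     ('k \<Rightarrow> 'w::ab_group_add \<Rightarrow> 'w) \<Rightarrow> ('g \<Rightarrow> 'w set) \<Rightarrow> ('u \<Rightarrow> 'v \<Rightarrow> 'w) \<Rightarrow> bool" where
  "even_bilinear scaleU GU scaleV GV scaleW GW m \<longleftrightarrow>
     (\<forall>x. Vector_Spaces.linear scaleV scaleW (m x)) \<and>
     (\<forall>y. Vector_Spaces.linear scaleU scaleW (\<lambda>x. m x y)) \<and>
     (\<forall>\<gamma> \<delta>. \<forall>x \<in> GU \<gamma>. \<forall>y \<in> GV \<delta>. m x y \<in> GW (\<gamma> + \<delta>))"

text \<open>
  The bilinear extension of an operation that is prescribed on homogeneous elements:
  \<open>m \<gamma> \<delta> x y\<close> is the prescribed value for \<open>x\<close> of degree \<open>\<gamma>\<close> and \<open>y\<close> of degree \<open>\<delta>\<close>.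
\<close>

definition bilinear_extension ::
    "('g \<Rightarrow> 'v::ab_group_add set) \<Rightarrow> ('g \<Rightarrow> 'g \<Rightarrow> 'v \<Rightarrow> 'v \<Rightarrow> 'w::ab_group_add) \<Rightarrow>
     'v \<Rightarrow> 'v \<Rightarrow> 'w" where
  "bilinear_extension G m x y =
     (\<Sum>\<gamma> | homogeneous_component G x \<gamma> \<noteq> 0. \<Sum>\<delta> | homogeneous_component G y \<delta> \<noteq> 0.
        m \<gamma> \<delta> (homogeneous_component G x \<gamma>) (homogeneous_component G y \<delta>))"


section \<open>Color Hom-algebras\<close>

locale commutation_factor =
  fixes \<epsilon> :: "'g::ab_group_add \<Rightarrow> 'g \<Rightarrow> 'k::field"
  assumes eps_nonzero: "\<epsilon> a b \<noteq> 0"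
    and eps_inverse: "\<epsilon> a b * \<epsilon> b a = 1"
    and eps_add_right: "\<epsilon> a (b + c) = \<epsilon> a b * \<epsilon> a c"
    and eps_add_left: "\<epsilon> (a + b) c = \<epsilon> a c * \<epsilon> b c"

locale color_hom_algebra = graded_space scale G + commutation_factor \<epsilon>
  for scale :: "'k::field \<Rightarrow> 'a::ab_group_add \<Rightarrow> 'a"
    and G :: "'g::ab_group_add \<Rightarrow> 'a set"
    and mul :: "'a \<Rightarrow> 'a \<Rightarrow> 'a"
    and \<epsilon> :: "'g \<Rightarrow> 'g \<Rightarrow> 'k"
    and \<alpha> :: "'a \<Rightarrow> 'a" +
  assumes even_mul: "even_bilinear scale G scale G scale G mul"
    and even_alpha: "even_linear scale G scale G \<alpha>"

locale comm_hom_associative = color_hom_algebra scale G dot \<epsilon> \<alpha>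
  for scale :: "'k::field \<Rightarrow> 'a::ab_group_add \<Rightarrow> 'a" (infixr \<open>*s\<close> 75)
    and G :: "'g::ab_group_add \<Rightarrow> 'a set"
    and dot :: "'a \<Rightarrow> 'a \<Rightarrow> 'a" (infixl \<open>\<cdot>\<close> 80)
    and \<epsilon> :: "'g \<Rightarrow> 'g \<Rightarrow> 'k"
    and \<alpha> :: "'a \<Rightarrow> 'a" +
  assumes hom_assoc:
      "x \<in> G a \<Longrightarrow> y \<in> G b \<Longrightarrow> z \<in> G c \<Longrightarrow> \<alpha> x \<cdot> (y \<cdot> z) = (x \<cdot> y) \<cdot> \<alpha> z"
    and eps_comm:
      "x \<in> G a \<Longrightarrow> y \<in> G b \<Longrightarrow> x \<cdot> y = \<epsilon> a b *s (y \<cdot> x)"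

locale hom_novikov = color_hom_algebra scale G dia \<epsilon> \<alpha>
  for scale :: "'k::field \<Rightarrow> 'a::ab_group_add \<Rightarrow> 'a" (infixr \<open>*s\<close> 75)
    and G :: "'g::ab_group_add \<Rightarrow> 'a set"
    and dia :: "'a \<Rightarrow> 'a \<Rightarrow> 'a" (infixl \<open>\<diamondop>\<close> 80)
    and \<epsilon> :: "'g \<Rightarrow> 'g \<Rightarrow> 'k"
    and \<alpha> :: "'a \<Rightarrow> 'a" +
  assumes hom_left_symmetric:
      "x \<in> G a \<Longrightarrow> y \<in> G b \<Longrightarrow> z \<in> G c \<Longrightarrow>
         (x \<diamondop> y) \<diamondop> \<alpha> z - \<alpha> x \<diamondop> (y \<diamondop> z)
         = \<epsilon> a b *s ((y \<diamondop> x) \<diamondop> \<alpha> z - \<alpha> y \<diamondop> (x \<diamondop> z))"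
    and hom_right_commutative:
      "x \<in> G a \<Longrightarrow> y \<in> G b \<Longrightarrow> z \<in> G c \<Longrightarrow>
         (x \<diamondop> y) \<diamondop> \<alpha> z = \<epsilon> b c *s ((x \<diamondop> z) \<diamondop> \<alpha> y)"

locale hom_novikov_poisson =
  comm_hom_associative scale G dot \<epsilon> \<alpha> + hom_novikov scale G dia \<epsilon> \<alpha>
  for scale :: "'k::field \<Rightarrow> 'a::ab_group_add \<Rightarrow> 'a" (infixr \<open>*s\<close> 75)
    and G :: "'g::ab_group_add \<Rightarrow> 'a set"
    and dot :: "'a \<Rightarrow> 'a \<Rightarrow> 'a" (infixl \<open>\<cdot>\<close> 80)
    and dia :: "'a \<Rightarrow> 'a \<Rightarrow> 'a" (infixl \<open>\<diamondop>\<close> 80)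
    and \<epsilon> :: "'g \<Rightarrow> 'g \<Rightarrow> 'k"
    and \<alpha> :: "'a \<Rightarrow> 'a" +
  assumes dot_dia:
      "x \<in> G a \<Longrightarrow> y \<in> G b \<Longrightarrow> z \<in> G c \<Longrightarrow>
         (x \<cdot> y) \<diamondop> \<alpha> z = \<epsilon> b c *s ((x \<diamondop> z) \<cdot> \<alpha> y)"
    and dia_dot:
      "x \<in> G a \<Longrightarrow> y \<in> G b \<Longrightarrow> z \<in> G c \<Longrightarrow>
         (x \<diamondop> y) \<cdot> \<alpha> z - \<alpha> x \<diamondop> (y \<cdot> z)
         = \<epsilon> a b *s ((y \<diamondop> x) \<cdot> \<alpha> z - \<alpha> y \<diamondop> (x \<cdot> z))"


section \<open>Bimodules\<close>

locale comm_hom_associative_bimodule =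
  comm_hom_associative scaleA GA dot \<epsilon> \<alpha> + V: graded_space scaleV GV
  for scaleA :: "'k::field \<Rightarrow> 'a::ab_group_add \<Rightarrow> 'a"
    and GA :: "'g::ab_group_add \<Rightarrow> 'a set"
    and dot :: "'a \<Rightarrow> 'a \<Rightarrow> 'a" (infixl \<open>\<cdot>\<close> 80)
    and \<epsilon> :: "'g \<Rightarrow> 'g \<Rightarrow> 'k"
    and \<alpha> :: "'a \<Rightarrow> 'a"
    and scaleV :: "'k \<Rightarrow> 'v::ab_group_add \<Rightarrow> 'v"
    and GV :: "'g \<Rightarrow> 'v set"
    and s :: "'a \<Rightarrow> 'v \<Rightarrow> 'v"
    and \<beta> :: "'v \<Rightarrow> 'v" +
  assumes even_beta: "even_linear scaleV GV scaleV GV \<beta>"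
    and even_s: "even_bilinear scaleA GA scaleV GV scaleV GV s"
    and s_dot:
      "x \<in> GA a \<Longrightarrow> y \<in> GA b \<Longrightarrow> v \<in> GV d \<Longrightarrow> s (x \<cdot> y) (\<beta> v) = s (\<alpha> x) (s y v)"

locale hom_novikov_bimodule =
  hom_novikov scaleA GA dia \<epsilon> \<alpha> + V: graded_space scaleV GV
  for scaleA :: "'k::field \<Rightarrow> 'a::ab_group_add \<Rightarrow> 'a"
    and GA :: "'g::ab_group_add \<Rightarrow> 'a set"
    and dia :: "'a \<Rightarrow> 'a \<Rightarrow> 'a" (infixl \<open>\<diamondop>\<close> 80)
    and \<epsilon> :: "'g \<Rightarrow> 'g \<Rightarrow> 'k"
    and \<alpha> :: "'a \<Rightarrow> 'a"
    and scaleV :: "'k \<Rightarrow> 'v::ab_group_add \<Rightarrow> 'v" (infixr \<open>*v\<close> 75)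
    and GV :: "'g \<Rightarrow> 'v set"
    and l :: "'a \<Rightarrow> 'v \<Rightarrow> 'v"
    and r :: "'a \<Rightarrow> 'v \<Rightarrow> 'v"
    and \<beta> :: "'v \<Rightarrow> 'v" +
  assumes even_beta: "even_linear scaleV GV scaleV GV \<beta>"
    and even_l: "even_bilinear scaleA GA scaleV GV scaleV GV l"
    and even_r: "even_bilinear scaleA GA scaleV GV scaleV GV r"
    and novikov_1:
      "x \<in> GA a \<Longrightarrow> y \<in> GA b \<Longrightarrow> v \<in> GV d \<Longrightarrow>
         l (x \<diamondop> y) (\<beta> v) - l (\<alpha> x) (l y v)
         = \<epsilon> a b *v (l (y \<diamondop> x) (\<beta> v) - l (\<alpha> y) (l x v))"
    and novikov_2:
      "x \<in> GA a \<Longrightarrow> y \<in> GA b \<Longrightarrow> v \<in> GV d \<Longrightarrow>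
         r (\<alpha> y) (l x v) - l (\<alpha> x) (r y v)
         = \<epsilon> a d *v (r (\<alpha> y) (r x v) - r (x \<diamondop> y) (\<beta> v))"
    and novikov_3:
      "x \<in> GA a \<Longrightarrow> y \<in> GA b \<Longrightarrow> v \<in> GV d \<Longrightarrow>
         r (\<alpha> y) (r x v) - r (x \<diamondop> y) (\<beta> v)
         = \<epsilon> d a *v (r (\<alpha> y) (l x v) - l (\<alpha> x) (r y v))"
    and novikov_4:
      "x \<in> GA a \<Longrightarrow> y \<in> GA b \<Longrightarrow> v \<in> GV d \<Longrightarrow>
         l (x \<diamondop> y) (\<beta> v) = \<epsilon> b d *v r (\<alpha> y) (l x v)"
    and novikov_5:
      "x \<in> GA a \<Longrightarrow> y \<in> GA b \<Longrightarrow> v \<in> GV d \<Longrightarrow>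
         r (\<alpha> y) (l x v) = \<epsilon> d b *v l (x \<diamondop> y) (\<beta> v)"
    and novikov_6:
      "x \<in> GA a \<Longrightarrow> y \<in> GA b \<Longrightarrow> v \<in> GV d \<Longrightarrow>
         r (\<alpha> y) (r x v) = \<epsilon> a b *v r (\<alpha> x) (r y v)"

locale hom_novikov_poisson_bimodule =
  hom_novikov_poisson scaleA GA dot dia \<epsilon> \<alpha> +
  comm_hom_associative_bimodule scaleA GA dot \<epsilon> \<alpha> scaleV GV s \<beta> +
  hom_novikov_bimodule scaleA GA dia \<epsilon> \<alpha> scaleV GV l r \<beta>
  for scaleA :: "'k::field \<Rightarrow> 'a::ab_group_add \<Rightarrow> 'a"
    and GA :: "'g::ab_group_add \<Rightarrow> 'a set"
    and dot :: "'a \<Rightarrow> 'a \<Rightarrow> 'a" (infixl \<open>\<cdot>\<close> 80)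
    and dia :: "'a \<Rightarrow> 'a \<Rightarrow> 'a" (infixl \<open>\<diamondop>\<close> 80)
    and \<epsilon> :: "'g \<Rightarrow> 'g \<Rightarrow> 'k"
    and \<alpha> :: "'a \<Rightarrow> 'a"
    and scaleV :: "'k \<Rightarrow> 'v::ab_group_add \<Rightarrow> 'v" (infixr \<open>*v\<close> 75)
    and GV :: "'g \<Rightarrow> 'v set"
    and s :: "'a \<Rightarrow> 'v \<Rightarrow> 'v"
    and l :: "'a \<Rightarrow> 'v \<Rightarrow> 'v"
    and r :: "'a \<Rightarrow> 'v \<Rightarrow> 'v"
    and \<beta> :: "'v \<Rightarrow> 'v" +
  assumes poisson_a:
      "x \<in> GA a \<Longrightarrow> y \<in> GA b \<Longrightarrow> v \<in> GV d \<Longrightarrow>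
         l (x \<cdot> y) (\<beta> v) = \<epsilon> a b *v s (\<alpha> y) (l x v)"
    and poisson_b:
      "x \<in> GA a \<Longrightarrow> y \<in> GA b \<Longrightarrow> v \<in> GV d \<Longrightarrow>
         r (\<alpha> y) (s x v) = \<epsilon> d b *v s (x \<diamondop> y) (\<beta> v)"
    and poisson_c:
      "x \<in> GA a \<Longrightarrow> y \<in> GA b \<Longrightarrow> v \<in> GV d \<Longrightarrow>
         r (\<alpha> y) (s x v) = s (\<alpha> x) (r y v)"
    and poisson_d:
      "x \<in> GA a \<Longrightarrow> y \<in> GA b \<Longrightarrow> v \<in> GV d \<Longrightarrow>
         s (x \<diamondop> y) (\<beta> v) - l (\<alpha> x) (s y v)
         = \<epsilon> a b *v (s (y \<diamondop> x) (\<beta> v) - l (\<alpha> y) (s x v))"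
    and poisson_e:
      "x \<in> GA a \<Longrightarrow> y \<in> GA b \<Longrightarrow> v \<in> GV d \<Longrightarrow>
         \<epsilon> (a + d) b *v (s (\<alpha> y) (l x v) - \<epsilon> a d *v s (\<alpha> y) (r x v))
         = \<epsilon> d b *v l (\<alpha> x) (s y v) - \<epsilon> a d *v r (x \<cdot> y) (\<beta> v)"


section \<open>Operations on the direct sum\<close>

definition sum_grading :: "('g \<Rightarrow> 'a set) \<Rightarrow> ('g \<Rightarrow> 'v set) \<Rightarrow> 'g \<Rightarrow> ('a \<times> 'v) set" where
  "sum_grading GA GV \<gamma> = GA \<gamma> \<times> GV \<gamma>"

definition sum_dot ::
    "('g \<Rightarrow> 'a::ab_group_add set) \<Rightarrow> ('a \<Rightarrow> 'a \<Rightarrow> 'a) \<Rightarrow> ('g \<Rightarrow> 'g \<Rightarrow> 'k) \<Rightarrow>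
     ('k \<Rightarrow> 'v::ab_group_add \<Rightarrow> 'v) \<Rightarrow> ('g \<Rightarrow> 'v set) \<Rightarrow> ('a \<Rightarrow> 'v \<Rightarrow> 'v) \<Rightarrow>
     'a \<times> 'v \<Rightarrow> 'a \<times> 'v \<Rightarrow> 'a \<times> 'v" where
  "sum_dot GA dot \<epsilon> scaleV GV s =
     bilinear_extension (sum_grading GA GV)
       (\<lambda>\<gamma>\<^sub>1 \<gamma>\<^sub>2 (x\<^sub>1, v\<^sub>1) (x\<^sub>2, v\<^sub>2). (dot x\<^sub>1 x\<^sub>2, s x\<^sub>1 v\<^sub>2 + scaleV (\<epsilon> \<gamma>\<^sub>1 \<gamma>\<^sub>2) (s x\<^sub>2 v\<^sub>1)))"

text \<open>
  This formula does not mention the degrees, so it is already the bilinear extension.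
\<close>

definition sum_dia ::
    "('a \<Rightarrow> 'a \<Rightarrow> 'a) \<Rightarrow> ('a \<Rightarrow> 'v::ab_group_add \<Rightarrow> 'v) \<Rightarrow> ('a \<Rightarrow> 'v \<Rightarrow> 'v) \<Rightarrow>
     'a \<times> 'v \<Rightarrow> 'a \<times> 'v \<Rightarrow> 'a \<times> 'v" where
  "sum_dia dia l r = (\<lambda>(x\<^sub>1, v\<^sub>1) (x\<^sub>2, v\<^sub>2). (dia x\<^sub>1 x\<^sub>2, l x\<^sub>1 v\<^sub>2 + r x\<^sub>2 v\<^sub>1))"

lemma homogeneous_decomposition_single:
  assumes "x \<in> G \<gamma>" "\<And>\<delta>. 0 \<in> G \<delta>"
  shows "homogeneous_decomposition G x (\<lambda>\<delta>. if \<delta> = \<gamma> then x else 0)"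
proof -
  have "{\<delta>. (if \<delta> = \<gamma> then x else 0) \<noteq> 0} = (if x = 0 then {} else {\<gamma>})" by auto
  then show ?thesis using assms unfolding homogeneous_decomposition_def by auto
qed

lemma homogeneous_decomposition_sum_grading:
  "homogeneous_decomposition (sum_grading GA GV) p f \<longleftrightarrow>
     homogeneous_decomposition GA (fst p) (fst \<circ> f) \<and>
     homogeneous_decomposition GV (snd p) (snd \<circ> f)"
proof -
  let ?S = "{\<gamma>. f \<gamma> \<noteq> 0}" and ?A = "{\<gamma>. fst (f \<gamma>) \<noteq> 0}" and ?V = "{\<gamma>. snd (f \<gamma>) \<noteq> 0}"
  have S: "?S = ?A \<union> ?V" by (auto simp: prod_eq_iff)
  have "fst (sum f ?S) = (\<Sum>\<gamma>\<in>?A. fst (f \<gamma>)) \<and> snd (sum f ?S) = (\<Sum>\<gamma>\<in>?V. snd (f \<gamma>))"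
    if fin: "finite ?S"
    unfolding fst_sum snd_sum
    by (intro conjI sum.mono_neutral_right) (use fin in \<open>auto simp: prod_eq_iff\<close>)
  then show ?thesis
    unfolding homogeneous_decomposition_def sum_grading_def
    using S by (auto simp: mem_Times_iff prod_eq_iff)
qed

lemma sum_dot_homogeneous:
  assumes "comm_hom_associative_bimodule scaleA GA dot \<epsilon> \<alpha> scaleV GV s \<beta>"
    and "x\<^sub>1 \<in> GA \<gamma>\<^sub>1" "v\<^sub>1 \<in> GV \<gamma>\<^sub>1" "x\<^sub>2 \<in> GA \<gamma>\<^sub>2" "v\<^sub>2 \<in> GV \<gamma>\<^sub>2"
  shows "sum_dot GA dot \<epsilon> scaleV GV s (x\<^sub>1, v\<^sub>1) (x\<^sub>2, v\<^sub>2)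
    = (dot x\<^sub>1 x\<^sub>2, s x\<^sub>1 v\<^sub>2 + scaleV (\<epsilon> \<gamma>\<^sub>1 \<gamma>\<^sub>2) (s x\<^sub>2 v\<^sub>1))"
proof -
  interpret comm_hom_associative_bimodule scaleA GA dot \<epsilon> \<alpha> scaleV GV s \<beta> by fact
  let ?G = "sum_grading GA GV"
  have zeros: "0 \<in> ?G \<gamma>" for \<gamma>
    using subspace_0[OF subspace_G] V.subspace_0[OF V.subspace_G]
    by (simp add: sum_grading_def zero_prod_def)
  have uniq: "f = g" if "homogeneous_decomposition ?G p f" "homogeneous_decomposition ?G p g" for p f g
  proof -
    have "fst \<circ> f = fst \<circ> g" "snd \<circ> f = snd \<circ> g"
      using that direct_sum V.direct_sum unfolding homogeneous_decomposition_sum_grading by blast+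
    then show ?thesis by (auto simp: fun_eq_iff prod_eq_iff)
  qed
  have comp: "homogeneous_component ?G p = (\<lambda>\<delta>. if \<delta> = \<gamma> then p else 0)" if "p \<in> ?G \<gamma>" for p \<gamma>
    unfolding homogeneous_component_def
    using uniq homogeneous_decomposition_single[of p ?G, OF that zeros] by blast
  have supp: "{\<delta>. (if \<delta> = \<gamma> then p else 0) \<noteq> 0} = (if p = 0 then {} else {\<gamma>})" for p :: "'b \<times> 'd" and \<gamma> :: 'c
    by auto
  have 0: "dot 0 y = 0" "dot y 0 = 0" for y
    using even_mul module_hom.zero[of scaleA scaleA] 
    unfolding even_bilinear_def module_hom_iff_linear by fastforce+
  have 1: "s 0 v = 0" "s y 0 = 0" for y v
    using even_s module_hom.zero[of scaleA scaleV] module_hom.zero[of scaleV scaleV]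
    unfolding even_bilinear_def module_hom_iff_linear by fastforce+
  have mem: "(x\<^sub>1, v\<^sub>1) \<in> ?G \<gamma>\<^sub>1" "(x\<^sub>2, v\<^sub>2) \<in> ?G \<gamma>\<^sub>2"
    using assms by (auto simp: sum_grading_def)
  show ?thesis
    unfolding sum_dot_def bilinear_extension_def mem[THEN comp] supp
    by (auto simp: zero_prod_def 0 1)
qed

end

theory Submission
  imports Defs
begin

text \<open>
  On homogeneous elements \<open>(x, u)\<close>, \<open>(y, v)\<close>, \<open>(z, w)\<close> every identity is an identity in \<open>A\<close>
  together with an identity in \<open>V\<close>. The latter is a sum of three parts, linear in \<open>w\<close>, \<open>v\<close> and \<open>u\<close>
  respectively, and each part follows from one bimodule axiom, combined with the
  \<open>\<epsilon>\<close>-commutativity of \<open>A\<close> in the case of Hom-associativity. The prescribed values of the first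
  product are bilinear for each fixed pair of degrees, so its extension is bilinear because taking
  homogeneous components is linear.
\<close>

section \<open>Bilinear extensions\<close>

context graded_space
begin

section \<open>Homogeneous components and their linearity\<close>

lemma homogeneous_component_eqI:
  "homogeneous_decomposition G x f \<Longrightarrow> homogeneous_component G x = f"
  unfolding homogeneous_component_def using direct_sum by (blast intro: the1_equality)

lemma decomposition_component:
  "homogeneous_decomposition G x (homogeneous_component G x)"
  using direct_sum homogeneous_component_eqI by metis

lemma homogeneous_component_mem: "homogeneous_component G x \<gamma> \<in> G \<gamma>"
  using decomposition_component unfolding homogeneous_decomposition_def by blast

lemma finite_homogeneous_component: "finite {\<gamma>. homogeneous_component G x \<gamma> \<noteq> 0}"
  using decomposition_component unfolding homogeneous_decomposition_def by blast

lemma sum_homogeneous_component: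
  assumes "finite S" "{\<gamma>. homogeneous_component G x \<gamma> \<noteq> 0} \<subseteq> S"
  shows "(\<Sum>\<gamma>\<in>S. homogeneous_component G x \<gamma>) = x"
proof -
  have "(\<Sum>\<gamma>\<in>S. homogeneous_component G x \<gamma>)
      = (\<Sum>\<gamma> | homogeneous_component G x \<gamma> \<noteq> 0. homogeneous_component G x \<gamma>)"
    by (rule sum.mono_neutral_right) (use assms in auto)
  then show ?thesis
    using decomposition_component[of x] unfolding homogeneous_decomposition_def by metis
qed

text \<open>Any finite superset of the support may serve as the index set, because the added terms
  are zero. This is needed because components of a sum can cancel, so its support is only contained
  in the union of the two supports.\<close>

lemma homogeneous_decompositionI:
  assumes "\<And>\<gamma>. f \<gamma> \<in> G \<gamma>" "finite S" "{\<gamma>. f \<gamma> \<noteq> 0} \<subseteq> S" "x = sum f S"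
  shows "homogeneous_decomposition G x f"
proof -
  have "sum f S = (\<Sum>\<gamma> | f \<gamma> \<noteq> 0. f \<gamma>)"
    by (rule sum.mono_neutral_right) (use assms in auto)
  then show ?thesis
    using assms finite_subset unfolding homogeneous_decomposition_def by blast
qed

lemma homogeneous_component_add:
  "homogeneous_component G (x + y) \<gamma> = homogeneous_component G x \<gamma> + homogeneous_component G y \<gamma>"
proof -
  let ?S = "{\<gamma>. homogeneous_component G x \<gamma> \<noteq> 0} \<union> {\<gamma>. homogeneous_component G y \<gamma> \<noteq> 0}"
  have "homogeneous_decomposition G (x + y)
      (\<lambda>\<gamma>. homogeneous_component G x \<gamma> + homogeneous_component G y \<gamma>)"
    by (rule homogeneous_decompositionI[of _ ?S])
      (auto simp: finite_homogeneous_component sum.distrib sum_homogeneous_component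
        intro!: subspace_add subspace_G homogeneous_component_mem)
  then show ?thesis by (simp add: homogeneous_component_eqI)
qed

lemma homogeneous_component_scale:
  "homogeneous_component G (scale c x) \<gamma> = scale c (homogeneous_component G x \<gamma>)"
proof -
  let ?S = "{\<gamma>. homogeneous_component G x \<gamma> \<noteq> 0}"
  have "homogeneous_decomposition G (scale c x) (\<lambda>\<gamma>. scale c (homogeneous_component G x \<gamma>))"
    by (rule homogeneous_decompositionI[of _ ?S])
      (auto simp: finite_homogeneous_component scale_sum_right[symmetric] sum_homogeneous_component
        intro!: subspace_scale subspace_G homogeneous_component_mem)
  then show ?thesis by (simp add: homogeneous_component_eqI)
qed

text \<open>Components depend linearly on the vector and \<open>m\<close> is linear in its last
  argument, so the only obstacle is that the range of summation depends on the vector. Since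
  \<open>m\<close> sends 0 to 0 there, the inner sum may run over any finite set containing the
  support, and a common set serves all the vectors involved.\<close>

lemma linear_bilinear_extension_right:
  assumes "\<And>\<gamma> \<delta> x. Vector_Spaces.linear scale scaleW (m \<gamma> \<delta> x)"
  shows "Vector_Spaces.linear scale scaleW (bilinear_extension G m x)"
proof -
  interpret W: vector_space scaleW
    using assms unfolding Vector_Spaces.linear_iff by blast
  have m_add: "m \<gamma> \<delta> x (y + z) = m \<gamma> \<delta> x y + m \<gamma> \<delta> x z"
    and m_scale: "m \<gamma> \<delta> x (scale c y) = scaleW c (m \<gamma> \<delta> x y)"
    and m_zero: "m \<gamma> \<delta> x 0 = 0" for \<gamma> \<delta> x y z c
    using assms[THEN Vector_Spaces.linear.axioms(3), THEN module_hom.add]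
      assms[THEN Vector_Spaces.linear.axioms(3), THEN module_hom.scale]
      assms[THEN Vector_Spaces.linear.axioms(3), THEN module_hom.zero] by blast+
  let ?supp = "\<lambda>y. {\<delta>. homogeneous_component G y \<delta> \<noteq> 0}"
  have ext: "bilinear_extension G m x y = (\<Sum>\<gamma>\<in>?supp x. \<Sum>\<delta>\<in>T.
      m \<gamma> \<delta> (homogeneous_component G x \<gamma>) (homogeneous_component G y \<delta>))"
    if "finite T" "?supp y \<subseteq> T" for y T
    unfolding bilinear_extension_def
    by (intro sum.cong sum.mono_neutral_left) (use that m_zero in auto)
  show ?thesis
    unfolding Vector_Spaces.linear_iff
  proof (intro conjI allI vector_space_axioms W.vector_space_axioms)
    fix y z
    have "?supp (y + z) \<subseteq> ?supp y \<union> ?supp z" by (auto simp: homogeneous_component_add)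
    then show "bilinear_extension G m x (y + z) = bilinear_extension G m x y + bilinear_extension G m x z"
      using ext[of "?supp y \<union> ?supp z"]
      by (simp add: finite_homogeneous_component homogeneous_component_add m_add sum.distrib)
  next
    fix c y
    have "?supp (scale c y) \<subseteq> ?supp y" by (auto simp: homogeneous_component_scale)
    then show "bilinear_extension G m x (scale c y) = scaleW c (bilinear_extension G m x y)"
      using ext[of "?supp y"]
      by (simp add: finite_homogeneous_component homogeneous_component_scale m_scale W.scale_sum_right)
  qed
qed

text \<open>Exchanging the two finite sums reduces linearity in the left argument to linearity in
  the right one.\<close>

lemma bilinear_extension_flip:
  "bilinear_extension G m x y = bilinear_extension G (\<lambda>\<gamma> \<delta> u v. m \<delta> \<gamma> v u) y x"
  unfolding bilinear_extension_def by (rule sum.swap)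

lemma linear_bilinear_extension_left:
  assumes "\<And>\<gamma> \<delta> y. Vector_Spaces.linear scale scaleW (\<lambda>x. m \<gamma> \<delta> x y)"
  shows "Vector_Spaces.linear scale scaleW (\<lambda>x. bilinear_extension G m x y)"
  unfolding bilinear_extension_flip[of m]
  using assms by (rule linear_bilinear_extension_right)

end

section \<open>The direct sum of graded spaces\<close>

text \<open>A homogeneous decomposition of a pair is exactly a pair of homogeneous decompositions of
  its coordinates, so existence and uniqueness are inherited from the two summands.\<close>

lemma graded_space_sum_grading:
  assumes "graded_space scaleA GA" "graded_space scaleV GV"
  shows "graded_space (module_prod.scale scaleA scaleV) (sum_grading GA GV)"
proof -
  interpret A: graded_space scaleA GA by fact
  interpret V: graded_space scaleV GV by fact
  interpret AV: vector_space_prod scaleA scaleV by unfold_locales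
  show ?thesis
  proof
    show "AV.p.subspace (sum_grading GA GV \<gamma>)" for \<gamma>
      unfolding sum_grading_def by (intro AV.subspace_Times A.subspace_G V.subspace_G)
    fix p
    obtain f g where "homogeneous_decomposition GA (fst p) f" "homogeneous_decomposition GV (snd p) g"
      using A.direct_sum V.direct_sum by meson
    then have "homogeneous_decomposition (sum_grading GA GV) p (\<lambda>\<gamma>. (f \<gamma>, g \<gamma>))"
      unfolding homogeneous_decomposition_sum_grading by (simp add: o_def)
    moreover have "h = h'"
      if "homogeneous_decomposition (sum_grading GA GV) p h"
        "homogeneous_decomposition (sum_grading GA GV) p h'" for h h'
    proof -
      have "fst \<circ> h = fst \<circ> h'" "snd \<circ> h = snd \<circ> h'"
        using that A.direct_sum V.direct_sum
        unfolding homogeneous_decomposition_sum_grading by blast+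
      then show ?thesis by (auto simp: fun_eq_iff prod_eq_iff)
    qed
    ultimately show "\<exists>!h. homogeneous_decomposition (sum_grading GA GV) p h" by blast
  qed
qed

section \<open>The semidirect product\<close>

lemma even_linearD:
  assumes "even_linear scaleU GU scaleV GV f"
  shows "Vector_Spaces.linear scaleU scaleV f" "x \<in> GU a \<Longrightarrow> f x \<in> GV a"
  using assms unfolding even_linear_def by auto

lemma even_bilinearD:
  assumes "even_bilinear scaleU GU scaleV GV scaleW GW m"
  shows "Vector_Spaces.linear scaleV scaleW (m x)"
    "Vector_Spaces.linear scaleU scaleW (\<lambda>x. m x y)"
    "x \<in> GU a \<Longrightarrow> y \<in> GV b \<Longrightarrow> m x y \<in> GW (a + b)"
  using assms unfolding even_bilinear_def by auto

context hom_novikov_poisson_bimodule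
begin

text \<open>The locale merge binds the fact name \<open>even_mul\<close> to only one of the two products.\<close>

lemma even_dot: "even_bilinear scaleA GA scaleA GA scaleA GA dot"
  by (rule color_hom_algebra.even_mul[OF comm_hom_associative.axioms(1)[OF comm_hom_associative_axioms]])

lemma even_dia: "even_bilinear scaleA GA scaleA GA scaleA GA dia"
  by (rule color_hom_algebra.even_mul[OF hom_novikov.axioms(1)[OF hom_novikov_axioms]])

lemmas linear_maps =
  even_alpha[THEN even_linearD(1)] even_beta[THEN even_linearD(1)]
  even_dot[THEN even_bilinearD(1)] even_dot[THEN even_bilinearD(2)]
  even_dia[THEN even_bilinearD(1)] even_dia[THEN even_bilinearD(2)]
  even_s[THEN even_bilinearD(1)] even_s[THEN even_bilinearD(2)]
  even_l[THEN even_bilinearD(1)] even_l[THEN even_bilinearD(2)]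
  even_r[THEN even_bilinearD(1)] even_r[THEN even_bilinearD(2)]

lemmas map_add = linear_maps[THEN Vector_Spaces.linear.axioms(3), THEN module_hom.add]
  and map_scale = linear_maps[THEN Vector_Spaces.linear.axioms(3), THEN module_hom.scale]

lemmas map_mem =
  even_alpha[THEN even_linearD(2)] even_beta[THEN even_linearD(2)]
  even_dot[THEN even_bilinearD(3)] even_dia[THEN even_bilinearD(3)]
  even_s[THEN even_bilinearD(3)] even_l[THEN even_bilinearD(3)] even_r[THEN even_bilinearD(3)]

abbreviation dot_sum (infixl \<open>\<odot>\<close> 80) where
  "dot_sum \<equiv> sum_dot GA dot \<epsilon> scaleV GV s"

abbreviation dia_sum (infixl \<open>\<star>\<close> 80) where
  "dia_sum \<equiv> sum_dia dia l r"

lemmas dot_sum = sum_dot_homogeneous[OF comm_hom_associative_bimodule_axioms]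

lemma dia_sum: "(x, u) \<star> (y, v) = (x \<diamondop> y, l x v + r y u)"
  by (simp add: sum_dia_def)

lemma eps_inverse_scale: "\<epsilon> a b *v \<epsilon> b a *v v = v"
  by (simp add: eps_inverse)

text \<open>Both sides are values of \<open>s\<close> at a product, by \<open>s_dot\<close>, and the
  two products differ by the factor from \<epsilon>-commutativity.\<close>

lemma s_swap:
  assumes "x \<in> GA a" "y \<in> GA b" "v \<in> GV d"
  shows "s (\<alpha> x) (s y v) = \<epsilon> a b *v s (\<alpha> y) (s x v)"
  using s_dot[OF assms] s_dot[OF assms(2,1,3)] eps_comm[OF assms(1,2)] by (simp add: map_scale)

text \<open>The second term has degree \<open>b + a\<close>, which is the degree of the first
  because the grading group is abelian.\<close>

lemma dot_sum_mem:
  assumes "x \<in> GA a" "u \<in> GV a" "y \<in> GA b" "v \<in> GV b"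
  shows "s x v + \<epsilon> a b *v s y u \<in> GV (a + b)"
  using map_mem(5)[OF assms(1,4)] map_mem(5)[OF assms(3,2)]
  by (auto simp: add.commute intro!: V.subspace_add V.subspace_scale V.subspace_G)

lemma dia_sum_mem:
  assumes "x \<in> GA a" "u \<in> GV a" "y \<in> GA b" "v \<in> GV b"
  shows "l x v + r y u \<in> GV (a + b)"
  using map_mem(6)[OF assms(1,4)] map_mem(7)[OF assms(3,2)]
  by (auto simp: add.commute intro!: V.subspace_add V.subspace_G)

section \<open>Evenness of the operations on the direct sum\<close>

lemma even_bilinear_dot_sum:
  "even_bilinear (module_prod.scale scaleA scaleV) (sum_grading GA GV)
     (module_prod.scale scaleA scaleV) (sum_grading GA GV)
     (module_prod.scale scaleA scaleV) (sum_grading GA GV) dot_sum"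
proof -
  interpret AV: vector_space_prod scaleA scaleV by unfold_locales
  interpret S: graded_space AV.scale "sum_grading GA GV"
    by (intro graded_space_sum_grading graded_space_axioms V.graded_space_axioms)
  \<comment> \<open>With the degrees held fixed the twist is a constant scalar, so \<open>?m\<close>
    is linear in each argument on the whole space, not only on homogeneous elements.\<close>
  let ?m = "\<lambda>\<gamma>\<^sub>1 \<gamma>\<^sub>2 (x\<^sub>1, v\<^sub>1) (x\<^sub>2, v\<^sub>2). (dot x\<^sub>1 x\<^sub>2, s x\<^sub>1 v\<^sub>2 + scaleV (\<epsilon> \<gamma>\<^sub>1 \<gamma>\<^sub>2) (s x\<^sub>2 v\<^sub>1))"
  have right: "Vector_Spaces.linear AV.scale AV.scale (?m \<gamma> \<delta> X)" for \<gamma> \<delta> X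
    by unfold_locales
      (auto simp: AV.scale_def map_add map_scale V.scale_right_distrib V.scale_left_commute split: prod.splits)
  have left: "Vector_Spaces.linear AV.scale AV.scale (\<lambda>X. ?m \<gamma> \<delta> X Y)" for \<gamma> \<delta> Y
    by unfold_locales
      (auto simp: AV.scale_def map_add map_scale V.scale_right_distrib V.scale_left_commute split: prod.splits)
  \<comment> \<open>The degrees do not occur on the left-hand side of \<open>dot_sum\<close>, so
    rewriting could not find them and they are supplied explicitly.\<close>
  have "\<forall>X \<in> sum_grading GA GV a. \<forall>Y \<in> sum_grading GA GV b. X \<odot> Y \<in> sum_grading GA GV (a + b)" for a b
    by (auto simp: sum_grading_def dot_sum[of _ a _ _ b] map_mem dot_sum_mem)
  moreover have "Vector_Spaces.linear AV.scale AV.scale (dot_sum X)" for X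
    unfolding sum_dot_def by (rule S.linear_bilinear_extension_right) (rule right)
  moreover have "Vector_Spaces.linear AV.scale AV.scale (\<lambda>X. X \<odot> Y)" for Y
    unfolding sum_dot_def by (rule S.linear_bilinear_extension_left) (rule left)
  ultimately show ?thesis unfolding even_bilinear_def by blast
qed

lemma even_bilinear_dia_sum:
  "even_bilinear (module_prod.scale scaleA scaleV) (sum_grading GA GV)
     (module_prod.scale scaleA scaleV) (sum_grading GA GV)
     (module_prod.scale scaleA scaleV) (sum_grading GA GV) dia_sum"
proof -
  interpret AV: vector_space_prod scaleA scaleV by unfold_locales
  have "Vector_Spaces.linear AV.scale AV.scale (dia_sum X)" for X
    by unfold_locales
      (auto simp: sum_dia_def AV.scale_def map_add map_scale V.scale_right_distrib split: prod.splits)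
  moreover have "Vector_Spaces.linear AV.scale AV.scale (\<lambda>X. X \<star> Y)" for Y
    by unfold_locales
      (auto simp: sum_dia_def AV.scale_def map_add map_scale V.scale_right_distrib split: prod.splits)
  moreover have "\<forall>X \<in> sum_grading GA GV a. \<forall>Y \<in> sum_grading GA GV b. X \<star> Y \<in> sum_grading GA GV (a + b)" for a b
    by (auto simp: sum_grading_def dia_sum map_mem dia_sum_mem)
  ultimately show ?thesis unfolding even_bilinear_def by blast
qed

lemma even_linear_map_prod:
  "even_linear (module_prod.scale scaleA scaleV) (sum_grading GA GV)
     (module_prod.scale scaleA scaleV) (sum_grading GA GV) (map_prod \<alpha> \<beta>)"
proof -
  interpret AV: vector_space_prod scaleA scaleV by unfold_locales
  have "Vector_Spaces.linear AV.scale AV.scale (map_prod \<alpha> \<beta>)"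
    by unfold_locales (auto simp: AV.scale_def map_add map_scale)
  then show ?thesis unfolding even_linear_def by (auto simp: sum_grading_def map_mem)
qed

section \<open>The defining identities on the direct sum\<close>

lemma hom_novikov_poisson_semidirect_product:
  "hom_novikov_poisson (module_prod.scale scaleA scaleV) (sum_grading GA GV)
     dot_sum dia_sum \<epsilon> (map_prod \<alpha> \<beta>)"
proof -
  interpret AV: vector_space_prod scaleA scaleV by unfold_locales
  interpret S: graded_space AV.scale "sum_grading GA GV"
    by (intro graded_space_sum_grading graded_space_axioms V.graded_space_axioms)
  show ?thesis
  proof unfold_locales
    show "even_bilinear AV.scale (sum_grading GA GV) AV.scale (sum_grading GA GV)
        AV.scale (sum_grading GA GV) dot_sum"
      by (rule even_bilinear_dot_sum)
    show "even_bilinear AV.scale (sum_grading GA GV) AV.scale (sum_grading GA GV)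
        AV.scale (sum_grading GA GV) dia_sum"
      by (rule even_bilinear_dia_sum)
    show "even_linear AV.scale (sum_grading GA GV) AV.scale (sum_grading GA GV) (map_prod \<alpha> \<beta>)"
      by (rule even_linear_map_prod)
  next
    fix X Y a b
    assume "X \<in> sum_grading GA GV a" "Y \<in> sum_grading GA GV b"
    moreover obtain x u y v where XY: "X = (x, u)" "Y = (y, v)" by fastforce
    ultimately have mem: "x \<in> GA a" "u \<in> GV a" "y \<in> GA b" "v \<in> GV b"
      by (auto simp: sum_grading_def)
    show "X \<odot> Y = AV.scale (\<epsilon> a b) (Y \<odot> X)"
      unfolding XY dot_sum[OF mem] dot_sum[OF mem(3,4,1,2)] AV.scale_prod
      using eps_comm[OF mem(1,3)] by (simp add: V.scale_right_distrib eps_inverse)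
  next
    fix X Y Z a b c
    assume XYZ_mem: "X \<in> sum_grading GA GV a" "Y \<in> sum_grading GA GV b" "Z \<in> sum_grading GA GV c"
    obtain x u y v z w where XYZ: "X = (x, u)" "Y = (y, v)" "Z = (z, w)" by fastforce
    have mem: "x \<in> GA a" "u \<in> GV a" "y \<in> GA b" "v \<in> GV b" "z \<in> GA c" "w \<in> GV c"
      using XYZ_mem by (auto simp: sum_grading_def XYZ)
    note alpha_mem = map_mem(1)[OF mem(1)] map_mem(2)[OF mem(2)] map_mem(1)[OF mem(3)]
      map_mem(2)[OF mem(4)] map_mem(1)[OF mem(5)] map_mem(2)[OF mem(6)]
    \<comment> \<open>The closed form of the first product holds only for arguments of known degree,
      so each product occurring below is listed with its degrees; inner products have the sum of two
      degrees.\<close>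
    note dots = dot_sum[OF mem(1-4)] dot_sum[OF mem(1,2,5,6)] dot_sum[OF mem(3-6)]
      dot_sum[OF alpha_mem(1,2) map_mem(3)[OF mem(3,5)] dot_sum_mem[OF mem(3-6)]]
      dot_sum[OF map_mem(3)[OF mem(1,3)] dot_sum_mem[OF mem(1-4)] alpha_mem(5,6)]
      dot_sum[OF map_mem(4)[OF mem(1,5)] dia_sum_mem[OF mem(1,2,5,6)] alpha_mem(3,4)]
      dot_sum[OF map_mem(4)[OF mem(1,3)] dia_sum_mem[OF mem(1-4)] alpha_mem(5,6)]
      dot_sum[OF map_mem(4)[OF mem(3,1)] dia_sum_mem[OF mem(3,4,1,2)] alpha_mem(5,6)]
    note V_simps = map_add map_scale V.scale_right_distrib V.scale_right_diff_distrib
    note expand = XYZ map_prod_simp dots dia_sum AV.scale_prod diff_Pair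

    \<comment> \<open>The \<open>w\<close> part is \<open>s_dot\<close>, and the \<open>v\<close>
      part is \<open>s_swap\<close> for \<open>x\<close>, \<open>z\<close>. The \<open>u\<close>
      part is \<open>s_dot\<close> followed by \<open>s_swap\<close> for \<open>y\<close>,
      \<open>z\<close>; its coefficient on both sides is
      \<open>\<epsilon> a b * \<epsilon> a c * \<epsilon> b c\<close>.\<close>
    have "s (\<alpha> x) (s y w + \<epsilon> b c *v s z v) + \<epsilon> a (b + c) *v s (dot y z) (\<beta> u)
      = s (dot x y) (\<beta> w) + \<epsilon> (a + b) c *v s (\<alpha> z) (s x v + \<epsilon> a b *v s y u)"
      unfolding s_dot[OF mem(1,3,6)] s_dot[OF mem(3,5,2)] s_swap[OF mem(3,5,2)] V_simps
        s_swap[OF mem(1,5,4)] V.scale_scale eps_add_left eps_add_right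
      by (simp add: algebra_simps)
    then show "map_prod \<alpha> \<beta> X \<odot> (Y \<odot> Z) = X \<odot> Y \<odot> map_prod \<alpha> \<beta> Z"
      unfolding expand using hom_assoc[OF mem(1,3,5)] by blast

    \<comment> \<open>Grouping by \<open>w\<close>, \<open>v\<close>, \<open>u\<close> produces the
      left-hand sides of \<open>novikov_1\<close>, \<open>novikov_2\<close> and
      \<open>novikov_3\<close>. In the last two \<open>z\<close> takes the place of
      \<open>y\<close>, and all three yield the same factor \<open>\<epsilon> a b\<close>.\<close>
    have "l (dia x y) (\<beta> w) + r (\<alpha> z) (l x v + r y u) - (l (\<alpha> x) (l y w + r z v) + r (dia y z) (\<beta> u))
      = (l (dia x y) (\<beta> w) - l (\<alpha> x) (l y w))
        + (r (\<alpha> z) (l x v) - l (\<alpha> x) (r z v)) + (r (\<alpha> z) (r y u) - r (dia y z) (\<beta> u))"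
      unfolding map_add by (simp add: algebra_simps)
    also have "\<dots> = \<epsilon> a b *v (l (dia y x) (\<beta> w) + r (\<alpha> z) (l y u + r x v)
        - (l (\<alpha> y) (l x w + r z u) + r (dia x z) (\<beta> v)))"
      unfolding novikov_1[OF mem(1,3,6)] novikov_2[OF mem(1,5,4)] novikov_3[OF mem(3,5,2)]
        V_simps by (simp add: algebra_simps)
    finally show "X \<star> Y \<star> map_prod \<alpha> \<beta> Z - map_prod \<alpha> \<beta> X \<star> (Y \<star> Z)
      = AV.scale (\<epsilon> a b) (Y \<star> X \<star> map_prod \<alpha> \<beta> Z - map_prod \<alpha> \<beta> Y \<star> (X \<star> Z))"
      unfolding expand using hom_left_symmetric[OF mem(1,3,5)] by blast

    have "l (dia x y) (\<beta> w) + r (\<alpha> z) (l x v + r y u)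
      = \<epsilon> b c *v (l (dia x z) (\<beta> v) + r (\<alpha> y) (l x w + r z u))"
      unfolding V_simps novikov_4[OF mem(1,3,6)] novikov_5[OF mem(1,5,4)] novikov_6[OF mem(3,5,2)]
      by (simp add: algebra_simps)
    then show "X \<star> Y \<star> map_prod \<alpha> \<beta> Z = AV.scale (\<epsilon> b c) (X \<star> Z \<star> map_prod \<alpha> \<beta> Y)"
      unfolding expand using hom_right_commutative[OF mem(1,3,5)] by blast

    have "l (dot x y) (\<beta> w) + r (\<alpha> z) (s x v + \<epsilon> a b *v s y u)
      = \<epsilon> b c *v (s (dia x z) (\<beta> v) + \<epsilon> (a + c) b *v s (\<alpha> y) (l x w + r z u))"
      unfolding V_simps poisson_a[OF mem(1,3,6)] poisson_b[OF mem(1,5,4)] poisson_c[OF mem(3,5,2)]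
      by (simp add: eps_add_left mult.left_commute[of "\<epsilon> b c"] eps_inverse)
    then show "X \<odot> Y \<star> map_prod \<alpha> \<beta> Z = AV.scale (\<epsilon> b c) (X \<star> Z \<odot> map_prod \<alpha> \<beta> Y)"
      unfolding expand using dot_dia[OF mem(1,3,5)] by blast

    \<comment> \<open>This is \<open>poisson_e\<close> for \<open>x\<close>, \<open>z\<close>,
      \<open>v\<close>, with the terms in \<open>l x v\<close> and \<open>l (\<alpha> x)\<close>
      collected on the left.\<close>
    have e_v: "\<epsilon> (a + b) c *v s (\<alpha> z) (l x v) - \<epsilon> b c *v l (\<alpha> x) (s z v)
      = \<epsilon> a b *v (\<epsilon> (b + a) c *v s (\<alpha> z) (r x v) - r (dot x z) (\<beta> v))"
      using poisson_e[OF mem(1,5,4)]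
      by (simp add: V.scale_right_diff_distrib algebra_simps)
    \<comment> \<open>Here \<open>poisson_e\<close> is used for \<open>y\<close>, \<open>z\<close>,
      \<open>u\<close>, where its twist is \<open>\<epsilon> b a\<close>. Multiplying by the inverse
      \<open>\<epsilon> a b\<close> frees the terms with \<open>r\<close> of the twist and puts the
      required factor on the terms with \<open>l\<close>.\<close>
    have "\<epsilon> a b *v (\<epsilon> (b + a) c *v (s (\<alpha> z) (l y u) - \<epsilon> b a *v s (\<alpha> z) (r y u)))
      = \<epsilon> a b *v (\<epsilon> a c *v l (\<alpha> y) (s z u) - \<epsilon> b a *v r (dot y z) (\<beta> u))"
      by (simp only: poisson_e[OF mem(3,5,2)])
    then have e_u: "\<epsilon> (a + b) c *v s (\<alpha> z) (r y u) - r (dot y z) (\<beta> u)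
      = \<epsilon> a b *v (\<epsilon> (b + a) c *v s (\<alpha> z) (l y u) - \<epsilon> a c *v l (\<alpha> y) (s z u))"
      unfolding V.scale_right_diff_distrib V.scale_left_commute[of _ "\<epsilon> b a"] eps_inverse_scale
      by (simp add: algebra_simps eps_inverse_scale)

    \<comment> \<open>The three groups are the \<open>w\<close>, \<open>v\<close> and
      \<open>u\<close> parts, settled by \<open>poisson_d\<close>, \<open>e_v\<close> and
      \<open>e_u\<close>.\<close>
    have "s (dia x y) (\<beta> w) + \<epsilon> (a + b) c *v s (\<alpha> z) (l x v + r y u)
        - (l (\<alpha> x) (s y w + \<epsilon> b c *v s z v) + r (dot y z) (\<beta> u))
      = (s (dia x y) (\<beta> w) - l (\<alpha> x) (s y w))
        + (\<epsilon> (a + b) c *v s (\<alpha> z) (l x v) - \<epsilon> b c *v l (\<alpha> x) (s z v))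
        + (\<epsilon> (a + b) c *v s (\<alpha> z) (r y u) - r (dot y z) (\<beta> u))"
      unfolding V_simps by (simp add: algebra_simps)
    also have "\<dots> = \<epsilon> a b *v (s (dia y x) (\<beta> w) + \<epsilon> (b + a) c *v s (\<alpha> z) (l y u + r x v)
        - (l (\<alpha> y) (s x w + \<epsilon> a c *v s z u) + r (dot x z) (\<beta> v)))"
      unfolding poisson_d[OF mem(1,3,6)] e_v e_u V_simps by (simp add: algebra_simps)
    finally show "X \<star> Y \<odot> map_prod \<alpha> \<beta> Z - map_prod \<alpha> \<beta> X \<star> (Y \<odot> Z)
      = AV.scale (\<epsilon> a b) (Y \<star> X \<odot> map_prod \<alpha> \<beta> Z - map_prod \<alpha> \<beta> Y \<star> (X \<odot> Z))"
      unfolding expand using dia_dot[OF mem(1,3,5)] by blast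
  qed
qed

end

theorem proposition3p7:
  fixes scaleA :: "'k::{alg_closed_field, field_char_0} \<Rightarrow> 'a::ab_group_add \<Rightarrow> 'a"
    and GA :: "'g::ab_group_add \<Rightarrow> 'a set"
    and dot dia :: "'a \<Rightarrow> 'a \<Rightarrow> 'a"
    and \<epsilon> :: "'g \<Rightarrow> 'g \<Rightarrow> 'k"
    and \<alpha> :: "'a \<Rightarrow> 'a"
    and scaleV :: "'k \<Rightarrow> 'v::ab_group_add \<Rightarrow> 'v"
    and GV :: "'g \<Rightarrow> 'v set"
    and s l r :: "'a \<Rightarrow> 'v \<Rightarrow> 'v"
    and \<beta> :: "'v \<Rightarrow> 'v"
  assumes "hom_novikov_poisson scaleA GA dot dia \<epsilon> \<alpha>"
    and "hom_novikov_poisson_bimodule scaleA GA dot dia \<epsilon> \<alpha> scaleV GV s l r \<beta>"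
  shows "hom_novikov_poisson (module_prod.scale scaleA scaleV) (sum_grading GA GV)
           (sum_dot GA dot \<epsilon> scaleV GV s) (sum_dia dia l r) \<epsilon> (map_prod \<alpha> \<beta>)"
  using assms(2) by (rule hom_novikov_poisson_bimodule.hom_novikov_poisson_semidirect_product)

end
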